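(* Let $M$ be a smooth manifold and consider the control-affine system $$\frac{d}{dt}x(t)=f(x(t))+\sum_{i=1}^mu_i(t)g_i(x(t))$$ on $M$, with $f,g_1,\dots,g_m$ smooth vector fields on $M$. Let $N\subseteq M$ be the controllable submanifold of the system, $\iota:N\hookrightarrow M$ the inclusion, and $h=(h_1,\dots,h_l)\in C^\infty(M,\mathbb{R}^l)$ an observable of the system. If the system has relative degree $(r_1,\dots,r_l)$ at $p\in N$ such that $r_1+\cdots+r_l=n$, the dimension of $N$, then the action of the associated Koopman system on the observable $$\phi=(h_1,\dots,\mathcal{L}_f^{r_1-1}h_1,\dots,h_l,\dots,\mathcal{L}_f^{r_l-1}h_l)'\in C^\infty(M,\mathbb{R}^n)$$ gives a linear system defined on a neighborhood $U\subseteq N$ of $p$ in the form $$\frac{d}{dt}U_t\phi=AU_t\phi+Bv(t),$$ where $$A=\begin{bmatrix}A_1&&\\&\ddots&\\&&A_l\end{bmatrix}\in\mathbb{R}^{n\times n},\qquad B=\begin{bmatrix}b_1&&\\&\ddots&\\&&b_l\end{bmatrix}\in\mathbb{R}^{n\times l}$$ are block diagonal, with $$A_i=\begin{bmatrix}0&1&0&\cdots&0\\0&0&1&\cdots&0\\\vdots&\vdots&\vdots&\ddots&\vdots\\0&0&0&\cdots&1\\0&0&0&\cdots&0\end{bmatrix}\in\mathbb{R}^{r_i\times r_i},\qquad b_i=\begin{bmatrix}0\\0\\\vdots\\0\\1\end{bmatrix}\in\mathbb{R}^{r_i},$$ and $v(t)=(v_1(t),\dots,v_l(t))'\in\mathbb{R}^l$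 with $$v_i(t)=\sum_{j=1}^mu_j(t)\,U_t\mathcal{L}_{g_j}\mathcal{L}_f^{r_i-1}(h_i\circ\iota)+U_t\mathcal{L}_f^{r_i}(h_i\circ\iota)$$ for all $i=1,\dots,l$.
   Context: The control inputs are functions $u_i:\mathbb{R}\to\mathbb{R}$; the starting time is $0$; for any choice of control inputs the vector field $f+\sum_iu_ig_i$ is assumed complete, and $\Phi_t$ denotes the resulting time-$t$ flow from time $0$. The Koopman operator is $U_th=h\circ\Phi_t$ for $h\in C^\infty(M)$, extended componentwise to $C^\infty(M,\mathbb{R}^k)$ ($\mathbb{R}^k$-valued smooth functions on $M$, also called observables). $\mathcal{L}_vh=dh(v)$ is the Lie derivative; $'$ denotes the transpose. The controllable submanifold $N$ is the maximal integral manifold (through the initial state under consideration) of the involutive distribution given by the Lie algebra generated by $f,g_1,\dots,g_m$; thus $f$ and $g_i$ restrict to vector fields on $N$, the flow preserves $N$, and Lie derivatives of functions on $N$ (such as $h_i\circ\iota$) are taken with respect to these restrictions; $U_t$ acts on functions on $N$ by composition with the restricted flow. Relative degree: the system (with observable $h$) has relative degree $(r_1,\dots,r_l)$ at $p\in N$ if in a neighborhood of $p$ in $N$: (i) for each $i=1,\dots,l$ and $j=1,\dots,m$, $\mathcal{L}_{g_j}\mathcal{L}_f^k(h_i\circ\iota)=0$ for all $k=0,\dots,r_i-2$; and (ii) the $l\times m$ matrix of functions with $(i,j)$-entry $\mathcal{L}_{g_j}\mathcal{L}_f^{r_i-1}(h_i\circ\iota)$ has rank $l$. The linear system being "defined on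 $U$" means that the displayed equation holds when evaluated at initial states $x(0)=q\in U$, for times $t$ for which the trajectory of the system stays in $U$; both sides are functions on $N$ (i.e. restricted to $N$ via $\iota$). *)

theory Defs
  imports "HOL-Analysis.Analysis" "Jordan_Normal_Form.DL_Rank"
begin

(* Jordan_Normal_Form and HOL-Analysis share these names; below they mean the
   variable-size vectors and matrices of Jordan_Normal_Form. *)
hide_const (open) Finite_Cartesian_Product.vec Finite_Cartesian_Product.mat
no_notation vec_nth (infixl "$" 90)

section \<open>Smooth manifolds and smooth functions\<close>

primrec Ck_on :: "nat \<Rightarrow> 'e::euclidean_space set \<Rightarrow> ('e \<Rightarrow> 'f::euclidean_space) \<Rightarrow> bool" where
  "Ck_on 0 S F \<longleftrightarrow> continuous_on S F"
| "Ck_on (Suc k) S F \<longleftrightarrow>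
     (\<forall>x\<in>S. F differentiable at x) \<and> (\<forall>v. Ck_on k S (\<lambda>x. frechet_derivative F (at x) v))"

definition smooth_on :: "'e::euclidean_space set \<Rightarrow> ('e \<Rightarrow> 'f::euclidean_space) \<Rightarrow> bool" where
  "smooth_on S F \<longleftrightarrow> open S \<and> (\<forall>k. Ck_on k S F)"

(* A space modelled on 'e, whose points form a subset of the type 'a.  The topology is
   part of the structure because an immersed submanifold has its own topology, in general
   finer than the subspace topology.  A chart is a domain together with a coordinate map. *)
record ('a, 'e) space =
  mtop :: "'a topology"
  atlas :: "('a set \<times> ('a \<Rightarrow> 'e)) set"

abbreviation points :: "('a, 'e) space \<Rightarrow> 'a set" where
  "points M \<equiv> topspace (mtop M)"

definition smooth_manifold :: "('a, 'e::euclidean_space) space \<Rightarrow> bool" where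
  "smooth_manifold M \<longleftrightarrow>
     Hausdorff_space (mtop M) \<and> second_countable (mtop M) \<and>
     (\<forall>(U, c)\<in>atlas M. openin (mtop M) U \<and> open (c ` U) \<and>
        homeomorphic_map (subtopology (mtop M) U) (top_of_set (c ` U)) c) \<and>
     (\<Union>(U, c)\<in>atlas M. U) = points M \<and>
     (\<forall>(U, c)\<in>atlas M. \<forall>(V, d)\<in>atlas M. smooth_on (c ` (U \<inter> V)) (d \<circ> inv_into U c))"

definition smooth_map ::
  "('b, 'n::euclidean_space) space \<Rightarrow> ('a, 'e::euclidean_space) space \<Rightarrow> ('b \<Rightarrow> 'a) \<Rightarrow> bool" where
  "smooth_map N M \<psi> \<longleftrightarrow> continuous_map (mtop N) (mtop M) \<psi> \<and>
     (\<forall>(V, c)\<in>atlas N. \<forall>(W, d)\<in>atlas M.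
        smooth_on (c ` {x\<in>V. \<psi> x \<in> W}) (d \<circ> \<psi> \<circ> inv_into V c))"

(* Functions are total on the type 'a; only their values at the points of M matter. *)
definition smooth_functions :: "('a, 'e::euclidean_space) space \<Rightarrow> ('a \<Rightarrow> real) set" where
  "smooth_functions M = {F. \<forall>(U, c)\<in>atlas M. smooth_on (c ` U) (F \<circ> inv_into U c)}"

definition component :: "('a \<Rightarrow> real vec) \<Rightarrow> nat \<Rightarrow> 'a \<Rightarrow> real" where
  "component h i = (\<lambda>q. h q $ i)"

definition observables :: "('a, 'e::euclidean_space) space \<Rightarrow> nat \<Rightarrow> ('a \<Rightarrow> real vec) set" where
  "observables M k =
     {h. (\<forall>q\<in>points M. h q \<in> carrier_vec k) \<and> (\<forall>i<k. component h i \<in> smooth_functions M)}"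

section \<open>Tangent vectors and vector fields\<close>

(* Tangent vectors at p are the derivations at p of the smooth functions.  As HOL functionals
   are total, they are normalised to 0 on non-smooth functions, so that equality of
   functionals is equality of tangent vectors. *)
type_synonym 'a functional = "('a \<Rightarrow> real) \<Rightarrow> real"

definition tangent_space :: "('a, 'e::euclidean_space) space \<Rightarrow> 'a \<Rightarrow> 'a functional set" where
  "tangent_space M p = {v.
     (\<forall>F\<in>smooth_functions M. \<forall>G\<in>smooth_functions M. v (\<lambda>q. F q + G q) = v F + v G) \<and>
     (\<forall>a. \<forall>F\<in>smooth_functions M. v (\<lambda>q. a * F q) = a * v F) \<and>
     (\<forall>F\<in>smooth_functions M. \<forall>G\<in>smooth_functions M.
        v (\<lambda>q. F q * G q) = F p * v G + G p * v F) \<and>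
     (\<forall>F. F \<notin> smooth_functions M \<longrightarrow> v F = 0)}"

definition differential ::
  "('a, 'e::euclidean_space) space \<Rightarrow> ('b \<Rightarrow> 'a) \<Rightarrow> 'b functional \<Rightarrow> 'a functional" where
  "differential M \<psi> v = (\<lambda>F. if F \<in> smooth_functions M then v (F \<circ> \<psi>) else 0)"

type_synonym 'a field = "'a \<Rightarrow> 'a functional"

(* dF(v) = v F when tangent vectors are derivations *)
definition lie_derivative :: "'a field \<Rightarrow> ('a \<Rightarrow> real) \<Rightarrow> 'a \<Rightarrow> real" where
  "lie_derivative X F = (\<lambda>q. X q F)"

definition smooth_vector_field :: "('a, 'e::euclidean_space) space \<Rightarrow> 'a field \<Rightarrow> bool" where
  "smooth_vector_field M X \<longleftrightarrow>
     (\<forall>q\<in>points M. X q \<in> tangent_space M q) \<and>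
     (\<forall>F\<in>smooth_functions M. lie_derivative X F \<in> smooth_functions M)"

definition lie_bracket :: "'a field \<Rightarrow> 'a field \<Rightarrow> 'a field" where
  "lie_bracket X Y =
     (\<lambda>q F. X q (lie_derivative Y F) - Y q (lie_derivative X F))"

inductive_set lie_algebra_generated :: "'a field set \<Rightarrow> 'a field set" for S where
  generator: "X \<in> S \<Longrightarrow> X \<in> lie_algebra_generated S"
| add: "X \<in> lie_algebra_generated S \<Longrightarrow> Y \<in> lie_algebra_generated S \<Longrightarrow>
    (\<lambda>q F. X q F + Y q F) \<in> lie_algebra_generated S"
| scale: "X \<in> lie_algebra_generated S \<Longrightarrow> (\<lambda>q F. a * X q F) \<in> lie_algebra_generated S"
| bracket: "X \<in> lie_algebra_generated S \<Longrightarrow> Y \<in> lie_algebra_generated S \<Longrightarrow>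
    lie_bracket X Y \<in> lie_algebra_generated S"

section \<open>The controllable submanifold\<close>

(* Submanifolds have their points in the same type as the ambient manifold, so the
   inclusion map is id. *)
definition immersed_submanifold ::
  "('a, 'e::euclidean_space) space \<Rightarrow> ('a, 'n::euclidean_space) space \<Rightarrow> bool" where
  "immersed_submanifold M N \<longleftrightarrow>
     smooth_manifold N \<and> points N \<subseteq> points M \<and> smooth_map N M id \<and>
     (\<forall>q\<in>points N. inj_on (differential M id) (tangent_space N q))"

definition integral_manifold ::
  "('a, 'e::euclidean_space) space \<Rightarrow> ('a \<Rightarrow> 'a functional set) \<Rightarrow>
   ('a, 'n::euclidean_space) space \<Rightarrow> bool" where
  "integral_manifold M \<Delta> N \<longleftrightarrow>
     immersed_submanifold M N \<and> points N \<noteq> {} \<and> connected_space (mtop N) \<and>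
     (\<forall>q\<in>points N. differential M id ` tangent_space N q = \<Delta> q)"

(* Competing integral manifolds may be modelled on the same type 'n: one that meets N has the
   same tangent spaces there, hence the same dimension. *)
definition maximal_integral_manifold ::
  "('a, 'e::euclidean_space) space \<Rightarrow> ('a \<Rightarrow> 'a functional set) \<Rightarrow>
   ('a, 'n::euclidean_space) space \<Rightarrow> bool" where
  "maximal_integral_manifold M \<Delta> N \<longleftrightarrow> integral_manifold M \<Delta> N \<and>
     (\<forall>N' :: ('a, 'n) space.
        integral_manifold M \<Delta> N' \<and> points N \<subseteq> points N' \<longrightarrow> points N' = points N)"

definition control_distribution ::
  "'a field \<Rightarrow> (nat \<Rightarrow> 'a field) \<Rightarrow> nat \<Rightarrow> 'a \<Rightarrow> 'a functional set" where
  "control_distribution f g m q =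
     {X q | X. X \<in> lie_algebra_generated (insert f (g ` {..<m}))}"

definition controllable_submanifold ::
  "('a, 'e::euclidean_space) space \<Rightarrow> 'a field \<Rightarrow> (nat \<Rightarrow> 'a field) \<Rightarrow> nat \<Rightarrow> 'a \<Rightarrow>
   ('a, 'n::euclidean_space) space \<Rightarrow> bool" where
  "controllable_submanifold M f g m x0 N \<longleftrightarrow>
     x0 \<in> points N \<and> maximal_integral_manifold M (control_distribution f g m) N"

(* The vector field on N that is related by the inclusion to X; well defined when X is
   tangent to N, since the differential of the inclusion is injective. *)
definition restrict_field ::
  "('a, 'e::euclidean_space) space \<Rightarrow> ('a, 'n::euclidean_space) space \<Rightarrow> 'a field \<Rightarrow> 'a field" where
  "restrict_field M N X =
     (\<lambda>q. THE v. v \<in> tangent_space N q \<and> differential M id v = X q)"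

section \<open>Control flows and the Koopman operator\<close>

(* The velocity of a curve x at time t is the derivation sending F to (F o x)'(t). *)
definition has_velocity ::
  "('a, 'e::euclidean_space) space \<Rightarrow> (real \<Rightarrow> 'a) \<Rightarrow> 'a functional \<Rightarrow> real \<Rightarrow> bool" where
  "has_velocity M x v t \<longleftrightarrow>
     (\<forall>F\<in>smooth_functions M. ((\<lambda>s. F (x s)) has_real_derivative v F) (at t))"

(* u j is the j-th control input; x solves the control system for all times. *)
definition trajectory ::
  "('a, 'e::euclidean_space) space \<Rightarrow> 'a field \<Rightarrow> (nat \<Rightarrow> 'a field) \<Rightarrow> nat \<Rightarrow>
   (nat \<Rightarrow> real \<Rightarrow> real) \<Rightarrow> (real \<Rightarrow> 'a) \<Rightarrow> bool" where
  "trajectory M f g m u x \<longleftrightarrow>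
     (\<forall>t. x t \<in> points M \<and>
        has_velocity M x (\<lambda>F. f (x t) F + (\<Sum>j<m. u j t * g j (x t) F)) t)"

(* Existence of such a \<Phi> is completeness of the controlled vector field. *)
definition control_flow ::
  "('a, 'e::euclidean_space) space \<Rightarrow> 'a field \<Rightarrow> (nat \<Rightarrow> 'a field) \<Rightarrow> nat \<Rightarrow>
   (nat \<Rightarrow> real \<Rightarrow> real) \<Rightarrow> (real \<Rightarrow> 'a \<Rightarrow> 'a) \<Rightarrow> bool" where
  "control_flow M f g m u \<Phi> \<longleftrightarrow>
     (\<forall>q\<in>points M. \<Phi> 0 q = q \<and> trajectory M f g m u (\<lambda>t. \<Phi> t q))"

(* Polymorphic in 'b: on vector-valued observables this is the componentwise action. *)
definition koopman :: "(real \<Rightarrow> 'a \<Rightarrow> 'a) \<Rightarrow> real \<Rightarrow> ('a \<Rightarrow> 'b) \<Rightarrow> 'a \<Rightarrow> 'b" where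
  "koopman \<Phi> t F = F \<circ> \<Phi> t"

section \<open>Relative degree and the linear system\<close>

(* r i - 1 is not truncated, since r i \<ge> 1. *)
definition relative_degree ::
  "('a, 'n::euclidean_space) space \<Rightarrow> 'a field \<Rightarrow> (nat \<Rightarrow> 'a field) \<Rightarrow> nat \<Rightarrow>
   ('a \<Rightarrow> real vec) \<Rightarrow> nat \<Rightarrow> (nat \<Rightarrow> nat) \<Rightarrow> 'a \<Rightarrow> bool" where
  "relative_degree N f g m h l r p \<longleftrightarrow>
     (\<forall>i<l. 1 \<le> r i) \<and>
     (\<exists>W. openin (mtop N) W \<and> p \<in> W \<and> (\<forall>q\<in>W.
        (\<forall>i<l. \<forall>j<m. \<forall>k. k + 2 \<le> r i \<longrightarrow>
           lie_derivative (g j) ((lie_derivative f ^^ k) (component h i)) q = 0) \<and>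
        vec_space.rank l (mat l m (\<lambda>(i, j).
           lie_derivative (g j) ((lie_derivative f ^^ (r i - 1)) (component h i)) q)) = l))"

definition stacked_observable ::
  "'a field \<Rightarrow> ('a \<Rightarrow> real vec) \<Rightarrow> nat \<Rightarrow> (nat \<Rightarrow> nat) \<Rightarrow> 'a \<Rightarrow> real vec" where
  "stacked_observable f h l r = (\<lambda>q. vec_of_list (concat
     (map (\<lambda>i. map (\<lambda>k. (lie_derivative f ^^ k) (component h i) q) [0..<r i]) [0..<l])))"

definition system_matrix :: "nat \<Rightarrow> (nat \<Rightarrow> nat) \<Rightarrow> real mat" where
  "system_matrix l r = diag_block_mat
     (map (\<lambda>i. mat (r i) (r i) (\<lambda>(a, b). if b = Suc a then 1 else 0)) [0..<l])"

definition input_matrix :: "nat \<Rightarrow> (nat \<Rightarrow> nat) \<Rightarrow> real mat" where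
  "input_matrix l r = diag_block_mat
     (map (\<lambda>i. mat (r i) 1 (\<lambda>(a, b). if Suc a = r i then 1 else 0)) [0..<l])"

definition linear_input ::
  "'a field \<Rightarrow> (nat \<Rightarrow> 'a field) \<Rightarrow> nat \<Rightarrow> ('a \<Rightarrow> real vec) \<Rightarrow> nat \<Rightarrow> (nat \<Rightarrow> nat) \<Rightarrow>
   (nat \<Rightarrow> real \<Rightarrow> real) \<Rightarrow> (real \<Rightarrow> 'a \<Rightarrow> 'a) \<Rightarrow> real \<Rightarrow> 'a \<Rightarrow> real vec" where
  "linear_input f g m h l r u \<Phi> t = (\<lambda>q. vec l (\<lambda>i.
     (\<Sum>j<m. u j t *
        koopman \<Phi> t (lie_derivative (g j) ((lie_derivative f ^^ (r i - 1)) (component h i))) q) +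
     koopman \<Phi> t ((lie_derivative f ^^ r i) (component h i)) q))"

(* Vectors of Jordan_Normal_Form carry no topology; differentiation is componentwise. *)
definition has_vec_derivative :: "(real \<Rightarrow> real vec) \<Rightarrow> real vec \<Rightarrow> real \<Rightarrow> bool" where
  "has_vec_derivative y d t \<longleftrightarrow>
     (\<forall>s. dim_vec (y s) = dim_vec d) \<and>
     (\<forall>k<dim_vec d. ((\<lambda>s. y s $ k) has_real_derivative d $ k) (at t))"

end

theory Submission
  imports Defs
begin

text \<open>
  Let \<open>x\<close> be a trajectory and put \<open>\<phi>\<^bsub>i,k\<^esub> = L\<^sub>f\<^sup>k h\<^sub>i\<close>. The definition of a velocity, applied to the
  function \<open>\<phi>\<^bsub>i,k\<^esub>\<close>, gives
  \<open>d/dt \<phi>\<^bsub>i,k\<^esub>(x(t)) = \<phi>\<^bsub>i,k+1\<^esub>(x(t)) + \<Sum>j. u\<^sub>j(t) (L\<^bsub>g_j\<^esub> \<phi>\<^bsub>i,k\<^esub>)(x(t))\<close>.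
  While \<open>x(t)\<close> stays in the neighbourhood \<open>U\<close> in which the relative degree is realised, the
  coefficients of the controls vanish for \<open>k + 1 < r\<^sub>i\<close>, so each block of the stacked observable is a
  chain of integrators; for \<open>k + 1 = r\<^sub>i\<close> the right-hand side is the input \<open>v\<^sub>i(t)\<close>. This is the
  linear system, once the block diagonal matrices are seen to shift each block up by one place and
  to put \<open>v\<^sub>i\<close> into the last one (\<open>integrator_chains_mult_block_vec\<close>).

  The velocity equation lives on \<open>M\<close>, whereas the relative degree and the inputs \<open>v\<^sub>i\<close> are stated with
  the fields restricted to \<open>N\<close>. Two facts bridge them. A tangent vector of \<open>N\<close> sees a function only
  through its values on \<open>N\<close> (\<open>tangent_vector_cong\<close>), and a field of \<open>M\<close> tangent to \<open>N\<close> acts at the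
  points of \<open>N\<close> on smooth functions of \<open>M\<close> as its restriction does (\<open>restrict_field_apply\<close>).
  Hence the iterated Lie derivatives along the restricted drift agree on \<open>N\<close> with those along \<open>f\<close>
  (\<open>restricted_iterate_eq\<close>).
\<close>

section \<open>Tangent vectors see functions only through their values on the manifold\<close>

lemma Ck_on_const: "Ck_on k S (\<lambda>x. c)"
  by (induction k arbitrary: c) auto

lemma Ck_on_cong_imp:
  assumes "open S" "\<And>x. x \<in> S \<Longrightarrow> F x = G x" "Ck_on k S F"
  shows "Ck_on k S G"
  using assms(2,3)
proof (induction k arbitrary: F G)
  case 0
  then show ?case by (simp cong: continuous_on_cong)
next
  case (Suc k)
  have G: "G differentiable at x" if "x \<in> S" for x
  proof -
    have "(F has_derivative frechet_derivative F (at x)) (at x)"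
      using Suc.prems(2) that by (simp add: frechet_derivative_works)
    then have "(G has_derivative frechet_derivative F (at x)) (at x)"
      by (rule has_derivative_transform_within_open[OF _ assms(1) that]) (rule Suc.prems(1))
    then show ?thesis by (rule differentiableI)
  qed
  have "frechet_derivative F (at x) v = frechet_derivative G (at x) v" if "x \<in> S" for x v
    using frechet_derivative_transform_within_open[of F x S G] assms(1) Suc.prems that by auto
  then have "Ck_on k S (\<lambda>x. frechet_derivative G (at x) v)" for v
    using Suc.IH[of "\<lambda>x. frechet_derivative F (at x) v"] Suc.prems(2) by auto
  with G show ?case by simp
qed

lemma smooth_on_cong_imp:
  assumes "\<And>x. x \<in> S \<Longrightarrow> F x = G x" "smooth_on S F"
  shows "smooth_on S G"
  using assms Ck_on_cong_imp[of S F G] by (auto simp: smooth_on_def)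

lemma smooth_functions_cong_imp:
  assumes "smooth_manifold N" "\<And>q. q \<in> points N \<Longrightarrow> F q = G q" "F \<in> smooth_functions N"
  shows "G \<in> smooth_functions N"
proof -
  have "smooth_on (c ` U) (G \<circ> inv_into U c)" if "(U, c) \<in> atlas N" for U c
  proof -
    have "openin (mtop N) U"
      using assms(1) that by (auto simp: smooth_manifold_def)
    then have "(F \<circ> inv_into U c) y = (G \<circ> inv_into U c) y" if "y \<in> c ` U" for y
      using assms(2) inv_into_into[OF that] openin_subset by fastforce
    moreover have "smooth_on (c ` U) (F \<circ> inv_into U c)"
      using assms(3) that by (auto simp: smooth_functions_def)
    ultimately show ?thesis by (rule smooth_on_cong_imp)
  qed
  then show ?thesis by (auto simp: smooth_functions_def)
qed

lemma const_smooth_function: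
  assumes "smooth_manifold N"
  shows "(\<lambda>q. c) \<in> smooth_functions N"
  using assms
  by (fastforce simp: smooth_functions_def smooth_manifold_def smooth_on_def comp_def Ck_on_const)

text \<open>
  The indicator \<open>e\<close> of the set of points is a smooth function with value 1 at \<open>q\<close>, and
  \<open>F x * e x = G x * e x\<close> holds for every \<open>x\<close>, also off the manifold. The product rule turns this into
  \<open>F q * v e + v F = G q * v e + v G\<close>, and \<open>F q = G q\<close>. If one of the two functions is not smooth,
  neither is the other, and tangent vectors vanish on both by their normalisation.
\<close>

lemma tangent_vector_cong:
  assumes N: "smooth_manifold N" and q: "q \<in> points N" and v: "v \<in> tangent_space N q"
    and FG: "\<And>x. x \<in> points N \<Longrightarrow> F x = G x"
  shows "v F = v G"
proof (cases "F \<in> smooth_functions N")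
  case True
  then have G: "G \<in> smooth_functions N"
    using smooth_functions_cong_imp[OF N] FG by blast
  define e :: "'a \<Rightarrow> real" where "e = indicator (points N)"
  have e: "e \<in> smooth_functions N"
    by (rule smooth_functions_cong_imp[OF N _ const_smooth_function[OF N, of 1]])
      (simp add: e_def)
  have leibniz: "v (\<lambda>x. H x * e x) = H q * v e + v H" if "H \<in> smooth_functions N" for H
    using v e that q by (simp add: tangent_space_def e_def)
  have "(\<lambda>x. F x * e x) = (\<lambda>x. G x * e x)"
    by (auto simp: e_def indicator_def FG)
  then show ?thesis
    using leibniz[OF True] leibniz[OF G] FG[OF q] by simp
next
  case False
  then have "G \<notin> smooth_functions N"
    using smooth_functions_cong_imp[OF N, of G F] FG by metis
  with False v show ?thesis by (simp add: tangent_space_def)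
qed

section \<open>Restricting fields to an integral manifold\<close>

text \<open>
  Fields of the distribution are tangent to its integral manifold, so the description defining the
  restricted field does have a solution; it has only one because an immersion has an injective
  differential.
\<close>

lemma restrict_field_tangent:
  assumes "integral_manifold M \<Delta> N" "q \<in> points N" "X q \<in> \<Delta> q"
  shows "restrict_field M N X q \<in> tangent_space N q"
    and "differential M id (restrict_field M N X q) = X q"
proof -
  have "X q \<in> differential M id ` tangent_space N q"
    using assms by (auto simp: integral_manifold_def)
  then obtain v where "v \<in> tangent_space N q" "differential M id v = X q"
    by auto
  moreover have "inj_on (differential M id) (tangent_space N q)"
    using assms by (auto simp: integral_manifold_def immersed_submanifold_def)
  ultimately have "\<exists>!v. v \<in> tangent_space N q \<and> differential M id v = X q"
    by (metis inj_onD)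
  from theI'[OF this]
  show "restrict_field M N X q \<in> tangent_space N q"
    and "differential M id (restrict_field M N X q) = X q"
    by (simp_all add: restrict_field_def)
qed

text \<open>
  The function to which the restricted field is applied may differ from \<open>F\<close> off \<open>N\<close>: iterated Lie
  derivatives along a restricted field carry no information there.
\<close>

lemma restrict_field_apply:
  assumes N: "integral_manifold M \<Delta> N" and q: "q \<in> points N" and X: "X q \<in> \<Delta> q"
    and F: "F \<in> smooth_functions M" and GF: "\<And>x. x \<in> points N \<Longrightarrow> G x = F x"
  shows "lie_derivative (restrict_field M N X) G q = lie_derivative X F q"
proof -
  have "smooth_manifold N"
    using N by (simp add: integral_manifold_def immersed_submanifold_def)
  then have "restrict_field M N X q G = restrict_field M N X q F"
    using tangent_vector_cong[OF _ q restrict_field_tangent(1)[where X = X, OF N q X]] GF by blast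
  also have "\<dots> = differential M id (restrict_field M N X q) F"
    using F by (simp add: differential_def)
  also have "\<dots> = X q F"
    by (simp only: restrict_field_tangent(2)[where X = X, OF N q X])
  finally show ?thesis by (simp add: lie_derivative_def)
qed

lemma iterated_lie_derivative_smooth:
  assumes "smooth_vector_field M X" "F \<in> smooth_functions M"
  shows "(lie_derivative X ^^ k) F \<in> smooth_functions M"
  using assms by (induction k) (auto simp: smooth_vector_field_def)

lemma restricted_iterate_eq:
  assumes N: "integral_manifold M \<Delta> N" and X: "smooth_vector_field M X"
    and tangent: "\<And>q. q \<in> points N \<Longrightarrow> X q \<in> \<Delta> q"
    and F: "F \<in> smooth_functions M" and q: "q \<in> points N"
  shows "(lie_derivative (restrict_field M N X) ^^ k) F q = (lie_derivative X ^^ k) F q"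
  using q
proof (induction k arbitrary: q)
  case (Suc k)
  then show ?case
    using restrict_field_apply[where X = X, OF N Suc.prems tangent[OF Suc.prems]
        iterated_lie_derivative_smooth[OF X F]] by simp
qed simp

section \<open>Vectors in blocks and chains of integrators\<close>

definition block_vec :: "nat \<Rightarrow> (nat \<Rightarrow> nat) \<Rightarrow> (nat \<Rightarrow> nat \<Rightarrow> real) \<Rightarrow> real vec" where
  "block_vec l r y = vec_of_list (concat (map (\<lambda>i. map (y i) [0..<r i]) [0..<l]))"

lemma sum_list_upt: "sum_list (map r [0..<l]) = (\<Sum>i<l. (r i :: nat))"
  by (induction l) auto

lemma dim_block_vec [simp]: "dim_vec (block_vec l r y) = (\<Sum>i<l. r i)"
  by (simp add: block_vec_def length_concat comp_def sum_list_upt)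

text \<open>
  Each entry position belongs to one block and one place in it, whatever the entries are; statements
  about block vectors can therefore be checked place by place.
\<close>

lemma block_vec_position:
  assumes "n < (\<Sum>i<l. r i)"
  obtains i k where "i < l" "k < r i" "\<forall>y. block_vec l r y $ n = y i k"
proof -
  define ix where "ix = concat (map (\<lambda>i. map (Pair i) [0..<r i]) [0..<l])"
  have eq: "block_vec l r y = vec_of_list (map (case_prod y) ix)" for y
    by (simp add: block_vec_def ix_def map_concat comp_def)
  have n: "n < length ix"
    using assms dim_block_vec[of l r "\<lambda>_ _. 0"] by (simp add: eq)
  obtain i k where ik: "ix ! n = (i, k)" by fastforce
  then have "(i, k) \<in> set ix" using n nth_mem by metis
  then have "i < l" "k < r i" by (auto simp: ix_def)
  moreover have "block_vec l r y $ n = y i k" for y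
    using n ik by (simp add: eq vec_of_list_index)
  ultimately show thesis using that by blast
qed

lemma block_vec_add:
  "block_vec l r y + block_vec l r z = block_vec l r (\<lambda>i k. y i k + z i k)"
proof (rule eq_vecI)
  fix n assume "n < dim_vec (block_vec l r (\<lambda>i k. y i k + z i k))"
  then have n: "n < (\<Sum>i<l. r i)" by simp
  from block_vec_position[OF n] obtain i k
    where "\<forall>y. block_vec l r y $ n = y i k" by blast
  with n show "(block_vec l r y + block_vec l r z) $ n = block_vec l r (\<lambda>i k. y i k + z i k) $ n"
    by simp
qed simp

lemma has_vec_derivative_block_vec:
  assumes "\<And>i k. i < l \<Longrightarrow> k < r i \<Longrightarrow> ((\<lambda>s. y s i k) has_real_derivative d i k) (at t)"
  shows "has_vec_derivative (\<lambda>s. block_vec l r (y s)) (block_vec l r d) t"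
  unfolding has_vec_derivative_def
proof (intro conjI allI impI)
  fix n assume "n < dim_vec (block_vec l r d)"
  then have n: "n < (\<Sum>i<l. r i)" by simp
  from block_vec_position[OF n]
  obtain i k where "i < l" "k < r i" "\<forall>y. block_vec l r y $ n = y i k" by blast
  then show "((\<lambda>s. block_vec l r (y s) $ n) has_real_derivative block_vec l r d $ n) (at t)"
    using assms by simp
qed simp

lemma vec_of_list_append: "vec_of_list (xs @ ys) = vec_of_list xs @\<^sub>v vec_of_list ys"
  by (rule eq_vecI) (auto simp: vec_of_list_index nth_append)

lemma diag_block_mat_mult_concat:
  fixes A :: "'i \<Rightarrow> 'a::semiring_0 mat"
  assumes "\<And>i. i \<in> set is \<Longrightarrow> length (xs i) = dim_col (A i)"
  shows "diag_block_mat (map A is) *\<^sub>v vec_of_list (concat (map xs is)) =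
    vec_of_list (concat (map (\<lambda>i. list_of_vec (A i *\<^sub>v vec_of_list (xs i))) is))"
  using assms
proof (induction "is")
  case Nil
  show ?case by (rule eq_vecI) auto
next
  case (Cons i "is")
  let ?D = "diag_block_mat (map A is)" and ?y = "vec_of_list (concat (map xs is))"
  have x: "vec_of_list (xs i) \<in> carrier_vec (dim_col (A i))"
    using Cons.prems[of i] by (intro carrier_vecI) simp
  have "length (concat (map xs is)) = sum_list (map (\<lambda>i. dim_col (A i)) is)"
    using Cons.prems by (induction "is") auto
  then have y: "?y \<in> carrier_vec (dim_col ?D)"
    by (intro carrier_vecI) (simp add: dim_diag_block_mat comp_def)
  have "diag_block_mat (map A (i # is)) *\<^sub>v vec_of_list (concat (map xs (i # is))) =
      four_block_mat (A i) (0\<^sub>m (dim_row (A i)) (dim_col ?D)) (0\<^sub>m (dim_row ?D) (dim_col (A i))) ?D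
        *\<^sub>v (vec_of_list (xs i) @\<^sub>v ?y)"
    by (simp add: Let_def vec_of_list_append)
  also have "\<dots> = (A i *\<^sub>v vec_of_list (xs i)) @\<^sub>v (?D *\<^sub>v ?y)"
    by (subst four_block_mat_mult_vec[OF _ _ _ _ x y]) (use x y in auto)
  also have "\<dots> = vec_of_list (concat (map (\<lambda>i. list_of_vec (A i *\<^sub>v vec_of_list (xs i))) (i # is)))"
    using Cons.IH Cons.prems by (simp add: vec_of_list_append vec_list)
  finally show ?case .
qed

lemma system_matrix_carrier: "system_matrix l r \<in> carrier_mat (\<Sum>i<l. r i) (\<Sum>i<l. r i)"
  unfolding system_matrix_def
  by (rule carrier_matI)
    (simp_all only: dim_diag_block_mat map_map comp_def dim_row_mat dim_col_mat sum_list_upt)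

lemma input_matrix_carrier: "input_matrix l r \<in> carrier_mat (\<Sum>i<l. r i) l"
  unfolding input_matrix_def
  by (rule carrier_matI)
    (simp_all only: dim_diag_block_mat map_map comp_def dim_row_mat dim_col_mat sum_list_upt,
      simp)

lemma shift_matrix_mult:
  "mat n n (\<lambda>(a, b). if b = Suc a then 1 else 0) *\<^sub>v vec_of_list (map y [0..<n]) =
    vec_of_list (map (\<lambda>k. if Suc k < n then y (Suc k) else (0::real)) [0..<n])"
proof (rule eq_vecI)
  fix k assume "k < dim_vec (vec_of_list (map (\<lambda>k. if Suc k < n then y (Suc k) else 0) [0..<n]))"
  then have k: "k < n" by simp
  let ?S = "mat n n (\<lambda>(a, b). if b = Suc a then 1 else (0::real))"
  have "(?S *\<^sub>v vec_of_list (map y [0..<n])) $ k = (\<Sum>b<n. (if b = Suc k then 1 else 0) * y b)"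
    using k by (simp add: scalar_prod_def vec_of_list_index atLeast0LessThan)
  also have "\<dots> = (\<Sum>b<n. if b = Suc k then y b else 0)"
    by (rule sum.cong) auto
  also have "\<dots> = (if Suc k < n then y (Suc k) else 0)"
    by simp
  finally show "(?S *\<^sub>v vec_of_list (map y [0..<n])) $ k =
      vec_of_list (map (\<lambda>k. if Suc k < n then y (Suc k) else 0) [0..<n]) $ k"
    using k by (simp add: vec_of_list_index)
qed simp

lemma last_unit_column_mult:
  "mat n 1 (\<lambda>(a, b). if Suc a = n then 1 else 0) *\<^sub>v vec_of_list [c] =
    vec_of_list (map (\<lambda>k. if Suc k = n then c else (0::real)) [0..<n])"
  by (rule eq_vecI) (auto simp: scalar_prod_def vec_of_list_index)

lemma system_matrix_mult_block_vec:
  "system_matrix l r *\<^sub>v block_vec l r y =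
    block_vec l r (\<lambda>i k. if Suc k < r i then y i (Suc k) else 0)"
  unfolding system_matrix_def block_vec_def
  by (subst diag_block_mat_mult_concat) (simp_all only: shift_matrix_mult list_vec, simp_all)

lemma input_matrix_mult_vec:
  "input_matrix l r *\<^sub>v vec l w = block_vec l r (\<lambda>i k. if Suc k = r i then w i else 0)"
proof -
  have eq: "vec l w = vec_of_list (concat (map (\<lambda>i. [w i]) [0..<l]))"
    by (rule eq_vecI) (auto simp: vec_of_list_index)
  show ?thesis
    unfolding eq input_matrix_def block_vec_def
    by (subst diag_block_mat_mult_concat) (simp_all only: last_unit_column_mult list_vec, simp_all)
qed

lemma integrator_chains_mult_block_vec:
  "system_matrix l r *\<^sub>v block_vec l r y + input_matrix l r *\<^sub>v vec l w =
    block_vec l r (\<lambda>i k. if Suc k < r i then y i (Suc k) else if Suc k = r i then w i else 0)"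
  unfolding system_matrix_mult_block_vec input_matrix_mult_vec block_vec_add
  by (rule arg_cong[where f = "block_vec l r"]) (intro ext, simp)

section \<open>The linear system\<close>

lemma stacked_observable_eq_block_vec:
  "stacked_observable f h l r q =
    block_vec l r (\<lambda>i k. (lie_derivative f ^^ k) (component h i) q)"
  by (simp add: stacked_observable_def block_vec_def)

lemma stacked_observable_smooth:
  assumes f: "smooth_vector_field M f" and h: "h \<in> observables M l"
  shows "stacked_observable f h l r \<in> observables M (\<Sum>i<l. r i)"
proof -
  have "component (stacked_observable f h l r) n \<in> smooth_functions M"
    if n: "n < (\<Sum>i<l. r i)" for n
  proof -
    obtain i k where i: "i < l" and ik: "\<forall>y. block_vec l r y $ n = y i k"
      using block_vec_position[OF n] by blast
    have "component (stacked_observable f h l r) n = (lie_derivative f ^^ k) (component h i)"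
      unfolding component_def[of "stacked_observable f h l r"]
      by (rule ext) (simp add: stacked_observable_eq_block_vec ik)
    then show ?thesis
      using iterated_lie_derivative_smooth[OF f] h i by (simp add: observables_def)
  qed
  then show ?thesis
    by (auto simp: observables_def stacked_observable_eq_block_vec intro!: carrier_vecI)
qed


theorem theorem7:
  fixes M :: "('a, 'e::euclidean_space) space"
    and N :: "('a, 'n::euclidean_space) space"
    and f :: "'a field" and g :: "nat \<Rightarrow> 'a field" and m :: nat
    and h :: "'a \<Rightarrow> real vec" and l :: nat and r :: "nat \<Rightarrow> nat"
    and x0 p :: 'a
    and \<U> :: "(nat \<Rightarrow> real \<Rightarrow> real) set"
    and \<Phi> :: "(nat \<Rightarrow> real \<Rightarrow> real) \<Rightarrow> real \<Rightarrow> 'a \<Rightarrow> 'a"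
  assumes "smooth_manifold M"
    and "smooth_vector_field M f"
    and "\<And>j. j < m \<Longrightarrow> smooth_vector_field M (g j)"
    and "\<And>u. u \<in> \<U> \<Longrightarrow> control_flow M f g m u (\<Phi> u)"
    and "controllable_submanifold M f g m x0 N"
    and "h \<in> observables M l"
    and "p \<in> points N"
    and "relative_degree N (restrict_field M N f) (\<lambda>j. restrict_field M N (g j)) m (h \<circ> id) l r p"
    and "(\<Sum>i<l. r i) = DIM('n)"
  shows "stacked_observable f h l r \<in> observables M DIM('n) \<and>
    system_matrix l r \<in> carrier_mat DIM('n) DIM('n) \<and>
    input_matrix l r \<in> carrier_mat DIM('n) l \<and>
    (\<exists>U. openin (mtop N) U \<and> p \<in> U \<and>
      (\<forall>u\<in>\<U>. \<forall>q\<in>U. \<forall>t. (\<forall>s\<in>closed_segment 0 t. \<Phi> u s q \<in> U) \<longrightarrow>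
        has_vec_derivative (\<lambda>s. koopman (\<Phi> u) s (stacked_observable f h l r) q)
          (system_matrix l r *\<^sub>v koopman (\<Phi> u) t (stacked_observable f h l r) q +
           input_matrix l r *\<^sub>v
             linear_input (restrict_field M N f) (\<lambda>j. restrict_field M N (g j)) m (h \<circ> id) l r
               u (\<Phi> u) t q)
          t))"
proof -
  define fN where "fN = restrict_field M N f"
  define gN where "gN j = restrict_field M N (g j)" for j
  define \<phi> where "\<phi> i k = (lie_derivative f ^^ k) (component h i)" for i k
  define \<phi>N where "\<phi>N i k = (lie_derivative fN ^^ k) (component h i)" for i k
  have N: "integral_manifold M (control_distribution f g m) N"
    using assms(5) by (simp add: controllable_submanifold_def maximal_integral_manifold_def)
  have f_tangent: "f q \<in> control_distribution f g m q" for q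
    by (auto simp: control_distribution_def intro: lie_algebra_generated.generator)
  have g_tangent: "g j q \<in> control_distribution f g m q" if "j < m" for j q
    using that by (auto simp: control_distribution_def intro!: exI[of _ "g j"]
        lie_algebra_generated.generator)
  have h: "component h i \<in> smooth_functions M" if "i < l" for i
    using assms(6) that by (simp add: observables_def)
  have \<phi>: "\<phi> i k \<in> smooth_functions M" if "i < l" for i k
    unfolding \<phi>_def using assms(2) h[OF that] by (rule iterated_lie_derivative_smooth)
  have \<phi>N: "\<phi>N i k q = \<phi> i k q" if "i < l" "q \<in> points N" for i k q
    unfolding \<phi>N_def \<phi>_def fN_def
    using restricted_iterate_eq[where X = f, OF N assms(2) f_tangent h[OF that(1)] that(2)] .
  have gN: "lie_derivative (gN j) (\<phi>N i k) q = g j q (\<phi> i k)"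
    if i: "i < l" and j: "j < m" and q: "q \<in> points N" for i j k q
  proof -
    have "lie_derivative (gN j) (\<phi>N i k) q = lie_derivative (g j) (\<phi> i k) q"
      unfolding gN_def
      by (rule restrict_field_apply[where X = "g j", OF N q g_tangent[OF j] \<phi>[OF i]]) (rule \<phi>N[OF i])
    then show ?thesis by (simp add: lie_derivative_def)
  qed
  obtain U where U: "openin (mtop N) U" "p \<in> U"
    and degree_U: "\<forall>q\<in>U. \<forall>i<l. \<forall>j<m. \<forall>k. k + 2 \<le> r i \<longrightarrow>
      lie_derivative (gN j) (\<phi>N i k) q = 0"
    using assms(8) unfolding relative_degree_def gN_def[symmetric] \<phi>N_def fN_def comp_id by blast
  then have degree: "lie_derivative (gN j) (\<phi>N i k) q = 0"
    if "q \<in> U" "i < l" "j < m" "k + 2 \<le> r i" for q i j k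
    using that by blast
  have U_points: "q \<in> points N" if "q \<in> U" for q
    using U(1) that openin_subset by blast
  have "has_vec_derivative (\<lambda>s. koopman (\<Phi> u) s (stacked_observable f h l r) q)
      (system_matrix l r *\<^sub>v koopman (\<Phi> u) t (stacked_observable f h l r) q +
       input_matrix l r *\<^sub>v linear_input fN gN m (h \<circ> id) l r u (\<Phi> u) t q) t"
    if u: "u \<in> \<U>" and q: "q \<in> U" and stays: "\<forall>s\<in>closed_segment 0 t. \<Phi> u s q \<in> U" for u q t
  proof -
    define x where "x s = \<Phi> u s q" for s
    define w where "w i = (\<Sum>j<m. u j t * lie_derivative (gN j) (\<phi>N i (r i - 1)) (x t)) +
      \<phi>N i (r i) (x t)" for i
    have xt: "x t \<in> U"
      using stays by (simp add: x_def)
    have "points N \<subseteq> points M"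
      using N by (simp add: integral_manifold_def immersed_submanifold_def)
    then have "trajectory M f g m u x"
      using assms(4)[OF u] U_points[OF q] by (auto simp: control_flow_def x_def[abs_def])
    then have velocity: "((\<lambda>s. \<phi> i k (x s)) has_real_derivative
        \<phi> i (Suc k) (x t) + (\<Sum>j<m. u j t * g j (x t) (\<phi> i k))) (at t)" if "i < l" for i k
      using \<phi>[OF that, of k]
      by (auto simp: trajectory_def has_velocity_def \<phi>_def lie_derivative_def)
    have "has_vec_derivative (\<lambda>s. block_vec l r (\<lambda>i k. \<phi> i k (x s)))
      (block_vec l r (\<lambda>i k. if Suc k < r i then \<phi> i (Suc k) (x t)
        else if Suc k = r i then w i else 0)) t"
    proof (rule has_vec_derivative_block_vec)
      fix i k assume i: "i < l" and k: "k < r i"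
      show "((\<lambda>s. \<phi> i k (x s)) has_real_derivative
        (if Suc k < r i then \<phi> i (Suc k) (x t) else if Suc k = r i then w i else 0)) (at t)"
      proof (cases "Suc k < r i")
        case True
        then have "g j (x t) (\<phi> i k) = 0" if "j < m" for j
          using degree[OF xt i that, of k] gN[OF i that U_points[OF xt]] by simp
        then show ?thesis using velocity[OF i, of k] True by simp
      next
        case False
        with k have last: "r i = Suc k" by simp
        have "w i = \<phi> i (Suc k) (x t) + (\<Sum>j<m. u j t * g j (x t) (\<phi> i k))"
          by (simp add: w_def last \<phi>N[OF i U_points[OF xt]] gN[OF i _ U_points[OF xt]])
        then show ?thesis using velocity[OF i, of k] last by simp
      qed
    qed
    moreover have "linear_input fN gN m (h \<circ> id) l r u (\<Phi> u) t q = vec l w"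
      by (simp add: linear_input_def koopman_def w_def[abs_def] \<phi>N_def x_def)
    moreover have "koopman (\<Phi> u) s (stacked_observable f h l r) q =
        block_vec l r (\<lambda>i k. \<phi> i k (x s))" for s
      by (simp add: koopman_def stacked_observable_eq_block_vec \<phi>_def x_def)
    ultimately show ?thesis
      by (simp only: integrator_chains_mult_block_vec)
  qed
  moreover have "stacked_observable f h l r \<in> observables M DIM('n)"
    using stacked_observable_smooth[OF assms(2,6), of r] assms(9) by simp
  moreover have "system_matrix l r \<in> carrier_mat DIM('n) DIM('n)"
    "input_matrix l r \<in> carrier_mat DIM('n) l"
    using system_matrix_carrier[of l r] input_matrix_carrier[of l r] assms(9) by simp_all
  ultimately show ?thesis
    using U unfolding fN_def gN_def[abs_def] by blast
qed

end
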